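(* Let $g\in C^1(\mathbb{R}^n)$, let $u(x,t)=\min_{|x-y|\le t}g(y)$, and let $(x_0,t_0)\in\mathbb{R}^n\times(0,\infty)$. Then: 1) If $L(x_0,t_0)$ is a singleton, then $u$ is differentiable at $(x_0,t_0)$, and $Du(x_0,t_0)=(\nabla u,u_t)(x_0,t_0)=(Dg(y_0),-|Dg(y_0)|)$, where $y_0\in L(x_0,t_0)$. 2) If $L(x_0,t_0)$ is not a singleton and there exists at least one $y_1\in L(x_0,t_0)$ such that $Dg(y_1)\neq 0$, then $u$ is not differentiable at $(x_0,t_0)$. 3) If $Dg(y)=0$ for all $y\in L(x_0,t_0)$, then $u$ is differentiable at $(x_0,t_0)$, and $Du(x_0,t_0)=0$.
   Context: $|\cdot|$ is the Euclidean norm. $u$ is the Hopf–Lax (viscosity) solution of the Eikonal equation $u_t+|\nabla u|=0$ in $\mathbb{R}^n\times(0,\infty)$ with $u=g$ at $t=0$, where $\nabla$ denotes the gradient in $x$. $L(x,t)=\{y\in\mathbb{R}^n : |y-x|\le t,\ u(x,t)=g(y)\}$ is the set of minimizers for $(x,t)$. *)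

theory Defs
  imports "HOL-Analysis.Analysis"
begin

(* LEAST is the minimum of the set of values: it exists for continuous g and t >= 0, as recorded
   below, while for t < 0 the value is unspecified. *)
definition hopf_lax :: "(real ^ 'n \<Rightarrow> real) \<Rightarrow> real ^ 'n \<Rightarrow> real \<Rightarrow> real"
  where "hopf_lax g x t = (LEAST m. m \<in> g ` {y. norm (x - y) \<le> t})"

definition minimizers :: "(real ^ 'n \<Rightarrow> real) \<Rightarrow> real ^ 'n \<Rightarrow> real \<Rightarrow> (real ^ 'n) set"
  where "minimizers g x t = {y. norm (y - x) \<le> t \<and> hopf_lax g x t = g y}"

lemma hopf_lax_is_minimum:
  fixes g :: "real ^ 'n \<Rightarrow> real"
  assumes "continuous_on UNIV g" "t \<ge> 0"
  shows "hopf_lax g x t \<in> g ` {y. norm (x - y) \<le> t}"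
    and "\<And>y. norm (x - y) \<le> t \<Longrightarrow> hopf_lax g x t \<le> g y"
proof -
  have eq: "{y. norm (x - y) \<le> t} = cball x t"
    by (auto simp: dist_norm)
  have "continuous_on (cball x t) g"
    using assms(1) continuous_on_subset by blast
  moreover have "cball x t \<noteq> {}"
    using assms(2) by simp
  ultimately obtain z where z: "z \<in> cball x t" "\<And>y. y \<in> cball x t \<Longrightarrow> g z \<le> g y"
    using continuous_attains_inf[OF compact_cball] by metis
  have "hopf_lax g x t = g z"
    unfolding hopf_lax_def eq by (rule Least_equality) (use z in auto)
  then show "hopf_lax g x t \<in> g ` {y. norm (x - y) \<le> t}"
    and "\<And>y. norm (x - y) \<le> t \<Longrightarrow> hopf_lax g x t \<le> g y"
    using z eq by (auto simp: dist_norm)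
qed

end

theory Submission
  imports Defs
begin

text \<open>
  Every minimizer \<open>y\<close> for \<open>(x0, t0)\<close> yields a smooth upper barrier
  \<open>(x, t) \<mapsto> g (x + (t / t0) (y - x0))\<close>, which touches the solution \<open>u\<close> at \<open>(x0, t0)\<close>.
  First-order optimality of \<open>y\<close> in the ball says that \<open>y - x0\<close> points opposite to \<open>Dg y\<close> and has
  length \<open>t0\<close> unless \<open>Dg y = 0\<close> (\<open>minimizer_gradient_alignment\<close>); hence the barrier has gradient
  \<open>(Dg y, - |Dg y|)\<close> at the contact point.

  If \<open>u\<close> is differentiable at \<open>(x0, t0)\<close>, its gradient is therefore that of every barrier, so all
  minimizers have the same \<open>Dg y\<close>. When this common gradient \<open>p\<close> is nonzero, alignment forces
  \<open>y = x0 - t0 p / |p|\<close>, and there is only one minimizer. This excludes differentiability in the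
  second case.

  Conversely, suppose that all minimizers have the same gradient \<open>p\<close>, as they do in the first and
  the third case. Minimizers for points near \<open>(x0, t0)\<close> accumulate only at minimizers for
  \<open>(x0, t0)\<close>, so gradients at or near them are uniformly close to \<open>p\<close>
  (\<open>gradients_near_minimizers\<close>). Pulling such a minimizer back to the ball of radius \<open>t0\<close> about
  \<open>x0\<close> and applying the mean value theorem bounds \<open>u\<close> from below by the linearization of the
  barrier up to a first-order small error. Thus \<open>u\<close> is differentiable with gradient
  \<open>(p, - |p|)\<close> (\<open>GDERIV_hopf_lax\<close>).
\<close>

section \<open>Minimizers over a closed ball\<close>

lemma GDERIV_imp_continuous_on:
  assumes "\<And>y. GDERIV g y :> Dg y"
  shows "continuous_on UNIV g"
  using assms unfolding gderiv_def
  by (meson continuous_at_imp_continuous_on has_derivative_continuous)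

lemma minimizers_nonempty:
  fixes g :: "real ^ 'n \<Rightarrow> real"
  assumes "continuous_on UNIV g" "t \<ge> 0"
  shows "minimizers g x t \<noteq> {}"
  using hopf_lax_is_minimum(1)[OF assms, of x]
  unfolding minimizers_def by (auto simp: norm_minus_commute)

lemma hopf_lax_le:
  fixes g :: "real ^ 'n \<Rightarrow> real"
  assumes "continuous_on UNIV g" "norm (y - x) \<le> t"
  shows "hopf_lax g x t \<le> g y"
proof (rule hopf_lax_is_minimum(2)[OF assms(1)])
  show "t \<ge> 0" using assms(2) norm_ge_zero order_trans by blast
  show "norm (x - y) \<le> t" using assms(2) by (simp add: norm_minus_commute)
qed

text \<open>Moving from a minimizer towards another point of a convex set cannot decrease the function
  to first order.\<close>

lemma variational_inequality:
  fixes g :: "'a::real_inner \<Rightarrow> real"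
  assumes "GDERIV g y :> p" "convex S" "y \<in> S" "z \<in> S"
    and min: "\<And>w. w \<in> S \<Longrightarrow> g y \<le> g w"
  shows "p \<bullet> (z - y) \<ge> 0"
proof (rule ccontr)
  assume neg: "\<not> ?thesis"
  define f where "f = (\<lambda>s. g (y + s *\<^sub>R (z - y)))"
  have "(g has_derivative (\<lambda>h. h \<bullet> p)) (at (y + 0 *\<^sub>R (z - y)))"
    using assms(1) by (simp add: gderiv_def)
  then have "(f has_derivative (\<lambda>s. (s *\<^sub>R (z - y)) \<bullet> p)) (at 0)"
    unfolding f_def by (rule has_derivative_compose[rotated]) (auto intro!: derivative_eq_intros)
  then have "DERIV f 0 :> p \<bullet> (z - y)"
    by (simp add: has_field_derivative_def inner_commute mult_commute_abs)
  then obtain d where d: "d > 0" "\<And>h. h > 0 \<Longrightarrow> h < d \<Longrightarrow> f h < f 0"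
    using DERIV_neg_dec_right[of f "p \<bullet> (z - y)" 0] neg by auto
  define h where "h = min 1 (d / 2)"
  have h: "h > 0" "h < d" "h \<le> 1" using d(1) by (auto simp: h_def min_def)
  have "y + h *\<^sub>R (z - y) = (1 - h) *\<^sub>R y + h *\<^sub>R z"
    by (simp add: algebra_simps)
  moreover have "(1 - h) *\<^sub>R y + h *\<^sub>R z \<in> S"
    using assms(2-4) h by (simp add: convexD)
  ultimately have "f 0 \<le> f h" using min by (simp add: f_def)
  then show False using d(2) h by fastforce
qed

text \<open>Testing the variational inequality at the point of the ball furthest in the direction
  \<open>- p\<close> gives equality in the Cauchy--Schwarz inequality: wherever the gradient
  is nonzero, the displacement of the minimizer is antiparallel to it and has full length. This is
  where the Eikonal relation between the time and space derivatives comes from.\<close>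

lemma minimizer_gradient_alignment:
  fixes g :: "real ^ 'n \<Rightarrow> real"
  assumes g: "continuous_on UNIV g" and p: "GDERIV g y :> p" and y: "y \<in> minimizers g x t"
  shows "p \<bullet> (y - x) = - (t * norm p)"
proof (rule antisym)
  have yt: "norm (y - x) \<le> t" and gy: "hopf_lax g x t = g y"
    using y by (auto simp: minimizers_def)
  then have t: "t \<ge> 0" using norm_ge_zero order_trans by blast
  have ball: "w \<in> cball x t \<longleftrightarrow> norm (w - x) \<le> t" for w
    by (simp add: dist_norm norm_minus_commute)
  let ?z = "x - t *\<^sub>R sgn p"
  have "p \<bullet> (?z - y) \<ge> 0"
  proof (rule variational_inequality[OF p convex_cball[of x t]])
    show "y \<in> cball x t" using yt ball by simp
    show "?z \<in> cball x t" using t unfolding ball by (simp add: norm_sgn)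
    show "g y \<le> g w" if "w \<in> cball x t" for w
      using hopf_lax_le[OF g, of w x t] that gy ball by simp
  qed
  moreover have "p \<bullet> sgn p = norm p"
    by (cases "p = 0") (simp_all add: sgn_div_norm power2_norm_eq_inner[symmetric] power2_eq_square)
  ultimately show "p \<bullet> (y - x) \<le> - (t * norm p)"
    by (simp add: inner_diff_right)
  have "- (p \<bullet> (y - x)) \<le> norm p * norm (y - x)"
    using Cauchy_Schwarz_ineq2[of p "y - x"] by linarith
  also have "\<dots> \<le> t * norm p" using yt by (metis mult.commute mult_right_mono norm_ge_zero)
  finally show "- (t * norm p) \<le> p \<bullet> (y - x)" by linarith
qed

text \<open>In a strictly convex ball only one point attains the extremal inner product with a nonzero
  vector.\<close>

lemma antiparallel_in_ball_unique:
  fixes p v :: "'a::real_inner"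
  assumes "p \<noteq> 0" "norm v \<le> t" "p \<bullet> v = - (t * norm p)"
  shows "v = - t *\<^sub>R sgn p"
proof -
  have sv: "v \<bullet> sgn p = - t"
    using assms(1,3) by (simp add: sgn_div_norm inner_commute)
  have "(norm (v + t *\<^sub>R sgn p))\<^sup>2 = (norm v)\<^sup>2 + 2 * t * (v \<bullet> sgn p) + t\<^sup>2 * (norm (sgn p))\<^sup>2"
    unfolding power2_norm_eq_inner
    by (simp add: inner_add_left inner_add_right inner_commute power2_eq_square algebra_simps)
  also have "\<dots> = (norm v)\<^sup>2 - t\<^sup>2"
    using assms(1) sv by (simp add: norm_sgn power2_eq_square)
  also have "\<dots> \<le> 0" using assms(2) by (simp add: power_mono)
  finally have "v + t *\<^sub>R sgn p = 0" by simp
  then show ?thesis by (simp add: add_eq_0_iff2)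
qed

section \<open>Smooth barriers touching the solution from above\<close>

text \<open>The minimizer \<open>y\<close> for \<open>(x0, t0)\<close> is carried along by the affine map sending the ball of
  radius \<open>t0\<close> about \<open>x0\<close> onto the ball of radius \<open>t\<close> about \<open>x\<close>, so it stays admissible.\<close>

definition barrier :: "('a::real_inner \<Rightarrow> real) \<Rightarrow> 'a \<Rightarrow> real \<Rightarrow> 'a \<Rightarrow> 'a \<times> real \<Rightarrow> real"
  where "barrier g x0 t0 y = (\<lambda>(x, t). g (x + (t / t0) *\<^sub>R (y - x0)))"

lemma barrier_touches:
  fixes g :: "real ^ 'n \<Rightarrow> real"
  assumes "y \<in> minimizers g x0 t0" "t0 > 0"
  shows "barrier g x0 t0 y (x0, t0) = hopf_lax g x0 t0"
  using assms by (simp add: barrier_def minimizers_def)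

lemma hopf_lax_le_barrier:
  fixes g :: "real ^ 'n \<Rightarrow> real"
  assumes "continuous_on UNIV g" "y \<in> minimizers g x0 t0" "t0 > 0" "t \<ge> 0"
  shows "hopf_lax g x t \<le> barrier g x0 t0 y (x, t)"
  unfolding barrier_def prod.case
proof (rule hopf_lax_le[OF assms(1)])
  have "t / t0 * norm (y - x0) \<le> t / t0 * t0"
    using assms by (intro mult_left_mono) (auto simp: minimizers_def)
  then show "norm (x + (t / t0) *\<^sub>R (y - x0) - x) \<le> t"
    using assms(3,4) by simp
qed

lemma GDERIV_barrier:
  fixes g :: "real ^ 'n \<Rightarrow> real"
  assumes g: "continuous_on UNIV g" and p: "GDERIV g y :> p"
    and y: "y \<in> minimizers g x0 t0" and t0: "t0 > 0"
  shows "GDERIV (barrier g x0 t0 y) (x0, t0) :> (p, - norm p)"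
proof -
  have "(g has_derivative (\<lambda>h. h \<bullet> p))
      (at (fst (x0, t0) + (snd (x0, t0) / t0) *\<^sub>R (y - x0)))"
    using p t0 by (simp add: gderiv_def)
  then have "((\<lambda>X. g (fst X + (snd X / t0) *\<^sub>R (y - x0))) has_derivative
      (\<lambda>H. (fst H + (snd H / t0) *\<^sub>R (y - x0)) \<bullet> p)) (at (x0, t0))"
    by (rule has_derivative_compose[rotated]) (use t0 in \<open>auto intro!: derivative_eq_intros\<close>)
  moreover have "(fst H + (snd H / t0) *\<^sub>R (y - x0)) \<bullet> p = H \<bullet> (p, - norm p)" for H
    using minimizer_gradient_alignment[OF g p y] t0
    by (cases H) (simp add: inner_add_left inner_commute[of "y - x0"])
  ultimately show ?thesis
    unfolding gderiv_def barrier_def by (simp add: case_prod_beta')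
qed

text \<open>A function touched from above by a differentiable one can only have the derivative of the
  latter, since the difference has a local maximum at the contact point.\<close>

lemma derivative_at_contact:
  fixes f h :: "'a::real_normed_vector \<Rightarrow> real"
  assumes f: "(f has_derivative f') (at a)" and h: "(h has_derivative h') (at a)"
    and le: "\<forall>\<^sub>F X in at a. f X \<le> h X" and eq: "f a = h a"
  shows "f' = h'"
proof -
  have "((\<lambda>X. f X - h X) has_derivative (\<lambda>v. f' v - h' v)) (at a)"
    by (intro derivative_intros f h)
  moreover have "\<forall>\<^sub>F X in at a. f X - h X \<le> f a - h a"
    using le by eventually_elim (simp add: eq)
  ultimately have "(\<lambda>v. f' v - h' v) = (\<lambda>v. 0)"
    by (rule has_derivative_local_max)
  then show ?thesis by (metis (no_types) eq_iff_diff_eq_0 ext)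
qed

lemma eventually_positive_time:
  assumes "(t0::real) > 0"
  shows "\<forall>\<^sub>F X in nhds (x0, t0). snd X > 0"
proof -
  have "(snd \<longlongrightarrow> t0) (nhds (x0, t0))"
    using tendsto_snd[OF filterlim_ident, of "(x0, t0)"] by simp
  then show ?thesis using assms by (rule order_tendstoD(1))
qed

lemma GDERIV_hopf_lax_eq:
  fixes g :: "real ^ 'n \<Rightarrow> real"
  assumes g: "continuous_on UNIV g" and p: "GDERIV g y :> p"
    and y: "y \<in> minimizers g x0 t0" and t0: "t0 > 0"
    and f': "((\<lambda>(x, t). hopf_lax g x t) has_derivative f') (at (x0, t0))"
  shows "f' = (\<lambda>H. H \<bullet> (p, - norm p))"
proof (rule derivative_at_contact[OF f'])
  show "(barrier g x0 t0 y has_derivative (\<lambda>H. H \<bullet> (p, - norm p))) (at (x0, t0))"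
    using GDERIV_barrier[OF g p y t0] by (simp add: gderiv_def)
  have "\<forall>\<^sub>F X in at (x0, t0). snd X > 0"
    using eventually_positive_time[OF t0, of x0] unfolding eventually_at_filter
    by eventually_elim simp
  then show "\<forall>\<^sub>F X in at (x0, t0). (case X of (x, t) \<Rightarrow> hopf_lax g x t) \<le> barrier g x0 t0 y X"
    by eventually_elim (use hopf_lax_le_barrier[OF g y t0] in auto)
  show "(case (x0, t0) of (x, t) \<Rightarrow> hopf_lax g x t) = barrier g x0 t0 y (x0, t0)"
    using barrier_touches[OF y t0] by simp
qed

section \<open>Stability of the minimizers\<close>

text \<open>Minimizers for nearby points stay in a bounded set, and the barrier bound passes to the
  limit, so every limit point is again a minimizer.\<close>

lemma minimizers_subsequential_limit:
  fixes g :: "real ^ 'n \<Rightarrow> real"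
  assumes g: "continuous_on UNIV g" and t0: "t0 > 0"
    and lim: "X \<longlonglongrightarrow> (x0, t0)"
    and Y: "\<And>n. Y n \<in> minimizers g (fst (X n)) (snd (X n))"
  obtains y r where "strict_mono r" "y \<in> minimizers g x0 t0" "(Y \<circ> r) \<longlonglongrightarrow> y"
proof -
  have fst: "(\<lambda>n. fst (X n)) \<longlonglongrightarrow> x0" and snd: "(\<lambda>n. snd (X n)) \<longlonglongrightarrow> t0"
    using tendsto_fst[OF lim] tendsto_snd[OF lim] by simp_all
  have dist: "norm (Y n - fst (X n)) \<le> snd (X n)" and val: "hopf_lax g (fst (X n)) (snd (X n)) = g (Y n)" for n
    using Y[of n] by (auto simp: minimizers_def)
  obtain B where B: "\<And>n. norm (fst (X n)) \<le> B"
    using convergent_imp_Bseq[OF convergentI[OF fst]] unfolding Bseq_def by blast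
  obtain C where C: "\<And>n. norm (snd (X n)) \<le> C"
    using convergent_imp_Bseq[OF convergentI[OF snd]] unfolding Bseq_def by blast
  have "norm (Y n) \<le> C + B" for n
  proof -
    have "norm (Y n) \<le> norm (Y n - fst (X n)) + norm (fst (X n))"
      by (metis diff_add_cancel norm_triangle_ineq)
    then show ?thesis using dist[of n] B[of n] C[of n] by simp
  qed
  then have "bounded (range Y)" by (auto simp: bounded_iff)
  then obtain y r where r: "strict_mono r" and conv: "(Y \<circ> r) \<longlonglongrightarrow> y"
    using bounded_imp_convergent_subsequence by blast
  have fst_r: "(\<lambda>n. fst (X (r n))) \<longlonglongrightarrow> x0" and snd_r: "(\<lambda>n. snd (X (r n))) \<longlonglongrightarrow> t0"
    using LIMSEQ_subseq_LIMSEQ[OF fst r] LIMSEQ_subseq_LIMSEQ[OF snd r] by (simp_all add: o_def)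
  have conv': "(\<lambda>n. Y (r n)) \<longlonglongrightarrow> y" using conv by (simp add: o_def)
  have ball: "norm (y - x0) \<le> t0"
    by (rule LIMSEQ_le[OF tendsto_norm[OF tendsto_diff[OF conv' fst_r]] snd_r]) (use dist in blast)
  obtain y0 where y0: "y0 \<in> minimizers g x0 t0"
    using minimizers_nonempty[OF g] t0 by (meson ex_in_conv less_imp_le)
  have cont: "isCont g w" for w
    using g by (simp add: continuous_on_eq_continuous_at)
  have "(\<lambda>n. g (Y (r n))) \<longlonglongrightarrow> g y"
    using isCont_tendsto_compose[OF cont conv'] .
  moreover have "(\<lambda>n. g (fst (X (r n)) + (snd (X (r n)) / t0) *\<^sub>R (y0 - x0))) \<longlonglongrightarrow>
      g (x0 + (t0 / t0) *\<^sub>R (y0 - x0))"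
    by (intro isCont_tendsto_compose[OF cont] tendsto_intros fst_r snd_r) (use t0 in simp)
  moreover have "g (Y (r n)) \<le> g (fst (X (r n)) + (snd (X (r n)) / t0) *\<^sub>R (y0 - x0))" for n
  proof -
    have "snd (X (r n)) \<ge> 0" using dist norm_ge_zero order_trans by blast
    then show ?thesis
      using hopf_lax_le_barrier[OF g y0 t0, of "snd (X (r n))" "fst (X (r n))"]
      by (simp add: val barrier_def case_prod_beta')
  qed
  ultimately have "g y \<le> g (x0 + (t0 / t0) *\<^sub>R (y0 - x0))"
    using LIMSEQ_le by blast
  also have "\<dots> = hopf_lax g x0 t0" using y0 t0 by (simp add: minimizers_def)
  finally have "hopf_lax g x0 t0 = g y" using hopf_lax_le[OF g ball] by simp
  then have "y \<in> minimizers g x0 t0" using ball by (simp add: minimizers_def)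
  then show ?thesis using that r conv by blast
qed

text \<open>If all minimizers at \<open>(x0, t0)\<close> share the gradient \<open>p\<close>, both quantities that enter the
  mean value estimate below are close to their limits uniformly over the minimizers of nearby
  points, and over points \<open>\<xi>\<close> close to them. Uniformity follows by contradiction from the
  existence of convergent subsequences.\<close>

lemma gradients_near_minimizers:
  fixes g :: "real ^ 'n \<Rightarrow> real"
  assumes Dg: "\<And>y. GDERIV g y :> Dg y" and C1: "continuous_on UNIV Dg" and t0: "t0 > 0"
    and p: "\<forall>y\<in>minimizers g x0 t0. Dg y = p" and e: "e > 0"
  shows "\<forall>\<^sub>F (x, t) in nhds (x0, t0). \<forall>y\<in>minimizers g x t. \<forall>\<xi>.
           norm (\<xi> - y) \<le> norm (x - x0) + \<bar>t - t0\<bar> \<longrightarrow>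
           norm (Dg \<xi> - p) < e \<and> \<bar>Dg \<xi> \<bullet> ((y - x) /\<^sub>R t) + norm p\<bar> < e"
    (is "eventually (\<lambda>(x, t). ?P x t) _")
proof (rule ccontr)
  note g = GDERIV_imp_continuous_on[OF Dg]
  assume "\<not> ?thesis"
  then have "\<forall>n. \<exists>X. dist X (x0, t0) < inverse (real (Suc n)) \<and> \<not> ?P (fst X) (snd X)"
    unfolding eventually_nhds_metric case_prod_beta'
    by (metis inverse_positive_iff_positive of_nat_0_less_iff zero_less_Suc)
  then obtain X where near: "\<And>n. dist (X n) (x0, t0) < inverse (real (Suc n))"
    and bad: "\<And>n. \<not> ?P (fst (X n)) (snd (X n))"
    by metis
  from bad have "\<exists>y \<xi>. y \<in> minimizers g (fst (X n)) (snd (X n)) \<and>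
      norm (\<xi> - y) \<le> norm (fst (X n) - x0) + \<bar>snd (X n) - t0\<bar> \<and>
      \<not> (norm (Dg \<xi> - p) < e \<and> \<bar>Dg \<xi> \<bullet> ((y - fst (X n)) /\<^sub>R snd (X n)) + norm p\<bar> < e)" for n
    by blast
  then obtain Y \<xi> where Y: "\<And>n. Y n \<in> minimizers g (fst (X n)) (snd (X n))"
    and \<xi>: "\<And>n. norm (\<xi> n - Y n) \<le> norm (fst (X n) - x0) + \<bar>snd (X n) - t0\<bar>"
    and far: "\<And>n. \<not> (norm (Dg (\<xi> n) - p) < e \<and>
        \<bar>Dg (\<xi> n) \<bullet> ((Y n - fst (X n)) /\<^sub>R snd (X n)) + norm p\<bar> < e)"
    by metis
  have "(\<lambda>n. dist (X n) (x0, t0)) \<longlonglongrightarrow> 0"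
    by (rule tendsto_sandwich[OF _ _ tendsto_const LIMSEQ_inverse_real_of_nat])
       (use near in \<open>auto intro!: always_eventually simp: less_imp_le\<close>)
  then have lim: "X \<longlonglongrightarrow> (x0, t0)" by (rule tendsto_dist_iff[THEN iffD2])
  obtain y r where r: "strict_mono r" and y: "y \<in> minimizers g x0 t0"
    and "(Y \<circ> r) \<longlonglongrightarrow> y"
    using minimizers_subsequential_limit[OF g t0 lim Y] by blast
  then have Ylim: "(\<lambda>n. Y (r n)) \<longlonglongrightarrow> y" by (simp add: o_def)
  have limr: "(\<lambda>n. X (r n)) \<longlonglongrightarrow> (x0, t0)"
    using LIMSEQ_subseq_LIMSEQ[OF lim r] by (simp add: o_def)
  have fst: "(\<lambda>n. fst (X (r n))) \<longlonglongrightarrow> x0" and snd: "(\<lambda>n. snd (X (r n))) \<longlonglongrightarrow> t0"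
    using tendsto_fst[OF limr] tendsto_snd[OF limr] by simp_all
  have "(\<lambda>n. norm (fst (X (r n)) - x0) + \<bar>snd (X (r n)) - t0\<bar>) \<longlonglongrightarrow> norm (x0 - x0) + \<bar>t0 - t0\<bar>"
    by (intro tendsto_intros fst snd)
  then have "(\<lambda>n. norm (fst (X (r n)) - x0) + \<bar>snd (X (r n)) - t0\<bar>) \<longlonglongrightarrow> 0" by simp
  then have "(\<lambda>n. \<xi> (r n) - Y (r n)) \<longlonglongrightarrow> 0"
    by (rule Lim_null_comparison[rotated]) (use \<xi> in \<open>auto intro!: always_eventually\<close>)
  from tendsto_add[OF this Ylim] have \<xi>lim: "(\<lambda>n. \<xi> (r n)) \<longlonglongrightarrow> y" by simp
  have "isCont Dg y" using C1 by (simp add: continuous_on_eq_continuous_at)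
  from isCont_tendsto_compose[OF this \<xi>lim] have Dlim: "(\<lambda>n. Dg (\<xi> (r n))) \<longlonglongrightarrow> p"
    using bspec[OF p y] by simp
  have "(\<lambda>n. norm (Dg (\<xi> (r n)) - p)) \<longlonglongrightarrow> norm (p - p)"
    by (intro tendsto_intros Dlim)
  then have "\<forall>\<^sub>F n in sequentially. norm (Dg (\<xi> (r n)) - p) < e"
    using e by (intro order_tendstoD(2)) auto
  moreover have "\<forall>\<^sub>F n in sequentially.
      \<bar>Dg (\<xi> (r n)) \<bullet> ((Y (r n) - fst (X (r n))) /\<^sub>R snd (X (r n))) + norm p\<bar> < e"
  proof (rule order_tendstoD(2))
    show "(\<lambda>n. \<bar>Dg (\<xi> (r n)) \<bullet> ((Y (r n) - fst (X (r n))) /\<^sub>R snd (X (r n))) + norm p\<bar>)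
        \<longlonglongrightarrow> \<bar>p \<bullet> ((y - x0) /\<^sub>R t0) + norm p\<bar>"
      by (intro tendsto_intros Dlim Ylim fst snd) (use t0 in simp)
    have "p \<bullet> (y - x0) = - (t0 * norm p)"
      using minimizer_gradient_alignment[OF g Dg y] bspec[OF p y] by simp
    then show "\<bar>p \<bullet> ((y - x0) /\<^sub>R t0) + norm p\<bar> < e"
      using e t0 by (simp add: inverse_eq_divide)
  qed
  ultimately have "\<forall>\<^sub>F n in sequentially. False"
    by eventually_elim (use far in blast)
  then show False by simp
qed

section \<open>Differentiability when the minimizers share one gradient\<close>

lemma mean_value_segment:
  fixes g :: "'a::real_inner \<Rightarrow> real"
  assumes Dg: "\<And>y. GDERIV g y :> Dg y"
  obtains \<xi> where "g y - g z = Dg \<xi> \<bullet> (y - z)" "norm (\<xi> - y) \<le> norm (y - z)"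
proof -
  define c where "c = (\<lambda>s. z + s *\<^sub>R (y - z))"
  have "((\<lambda>s. g (c s)) has_derivative (\<lambda>h. (h *\<^sub>R (y - z)) \<bullet> Dg (c s))) (at s within {0..1})" for s
    by (rule has_derivative_compose[OF _ Dg[unfolded gderiv_def]])
       (auto simp: c_def intro!: derivative_eq_intros)
  from mvt_very_simple[OF zero_le_one this] obtain s where s: "s \<in> {0..1}"
    and eq: "g (c 1) - g (c 0) = ((1 - 0) *\<^sub>R (y - z)) \<bullet> Dg (c s)" by blast
  have "c s - y = (s - 1) *\<^sub>R (y - z)" by (simp add: c_def algebra_simps)
  then have "norm (c s - y) = \<bar>s - 1\<bar> * norm (y - z)" by simp
  also have "\<dots> \<le> norm (y - z)" using s by (intro mult_left_le_one_le) auto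
  finally show ?thesis using eq that[of "c s"] by (simp add: c_def inner_commute)
qed

text \<open>The lower bound runs the barrier construction backwards: a minimizer \<open>y\<close> for \<open>(x, t)\<close> is
  mapped to a competitor \<open>z\<close> for \<open>(x0, t0)\<close>, and \<open>g y - g z\<close> is expanded by the mean value
  theorem. Only the gradients near minimizers of nearby points enter.\<close>

lemma hopf_lax_lower_expansion:
  fixes g :: "real ^ 'n \<Rightarrow> real"
  assumes Dg: "\<And>y. GDERIV g y :> Dg y" and C1: "continuous_on UNIV Dg" and t0: "t0 > 0"
    and p: "\<forall>y\<in>minimizers g x0 t0. Dg y = p" and e: "e > 0"
  shows "\<forall>\<^sub>F (x, t) in nhds (x0, t0).
           hopf_lax g x0 t0 + (p \<bullet> (x - x0) - norm p * (t - t0)) - e * (norm (x - x0) + \<bar>t - t0\<bar>)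
             \<le> hopf_lax g x t"
  using gradients_near_minimizers[OF Dg C1 t0 p e] eventually_positive_time[OF t0, of x0]
proof eventually_elim
  case (elim X)
  note g = GDERIV_imp_continuous_on[OF Dg]
  obtain x t where X: "X = (x, t)" by (cases X)
  have t: "t > 0" using elim X by simp
  obtain y where y: "y \<in> minimizers g x t"
    using minimizers_nonempty[OF g] t by (meson ex_in_conv less_imp_le)
  define v where "v = (y - x) /\<^sub>R t"
  have nv: "norm v \<le> 1" using y t by (simp add: v_def minimizers_def inverse_eq_divide)
  have yv: "y = x + t *\<^sub>R v" using t by (simp add: v_def)
  define z where "z = x0 + t0 *\<^sub>R v"
  have yz: "y - z = (x - x0) + (t - t0) *\<^sub>R v"
    by (simp add: yv z_def algebra_simps)
  have "norm (z - x0) \<le> t0" using t0 nv by (simp add: z_def mult_left_le)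
  then have uz: "hopf_lax g x0 t0 \<le> g z" by (rule hopf_lax_le[OF g])
  have uy: "hopf_lax g x t = g y" using y by (simp add: minimizers_def)
  obtain \<xi> where mv: "g y - g z = Dg \<xi> \<bullet> (y - z)" and \<xi>: "norm (\<xi> - y) \<le> norm (y - z)"
    using mean_value_segment[OF Dg] by blast
  have "norm (y - z) \<le> norm (x - x0) + norm ((t - t0) *\<^sub>R v)"
    unfolding yz by (rule norm_triangle_ineq)
  also have "\<dots> \<le> norm (x - x0) + \<bar>t - t0\<bar>" using nv by (simp add: mult_left_le)
  finally have "norm (\<xi> - y) \<le> norm (x - x0) + \<bar>t - t0\<bar>" using \<xi> by simp
  then have D: "norm (Dg \<xi> - p) < e" and Dv: "\<bar>Dg \<xi> \<bullet> v + norm p\<bar> < e"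
    using elim(1) y unfolding X v_def by auto
  have "\<bar>(Dg \<xi> - p) \<bullet> (x - x0)\<bar> \<le> norm (Dg \<xi> - p) * norm (x - x0)"
    by (rule Cauchy_Schwarz_ineq2)
  also have "\<dots> \<le> e * norm (x - x0)" using D by (intro mult_right_mono) auto
  finally have 1: "(Dg \<xi> - p) \<bullet> (x - x0) \<ge> - (e * norm (x - x0))" by linarith
  have "\<bar>(t - t0) * (Dg \<xi> \<bullet> v + norm p)\<bar> \<le> \<bar>t - t0\<bar> * e"
    unfolding abs_mult using Dv by (intro mult_left_mono) auto
  then have 2: "(t - t0) * (Dg \<xi> \<bullet> v + norm p) \<ge> - (e * \<bar>t - t0\<bar>)"
    by (simp add: mult.commute)
  have "g y - g z = (p \<bullet> (x - x0) - norm p * (t - t0))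
      + (Dg \<xi> - p) \<bullet> (x - x0) + (t - t0) * (Dg \<xi> \<bullet> v + norm p)"
    unfolding mv yz by (simp add: inner_add_right inner_diff_left algebra_simps)
  then show ?case using 1 2 uz uy by (simp add: X algebra_simps)
qed

text \<open>The solution is squeezed between a barrier and the lower expansion, which agree to first
  order. A common gradient occurs both for a unique minimizer and for a
  possibly large set of critical minimizers.\<close>

theorem GDERIV_hopf_lax:
  fixes g :: "real ^ 'n \<Rightarrow> real"
  assumes Dg: "\<And>y. GDERIV g y :> Dg y" and C1: "continuous_on UNIV Dg" and t0: "t0 > 0"
    and p: "\<forall>y\<in>minimizers g x0 t0. Dg y = p"
  shows "GDERIV (\<lambda>(x, t). hopf_lax g x t) (x0, t0) :> (p, - norm p)"
  unfolding gderiv_def has_derivative_within_alt2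
proof (intro conjI allI impI)
  note g = GDERIV_imp_continuous_on[OF Dg]
  let ?u = "\<lambda>(x, t). hopf_lax g x t" and ?l = "\<lambda>H. H \<bullet> (p, - norm p)"
  show "bounded_linear ?l" by (rule bounded_linear_inner_left)
  fix e :: real assume e: "e > 0"
  obtain y where y: "y \<in> minimizers g x0 t0"
    using minimizers_nonempty[OF g] t0 by (meson ex_in_conv less_imp_le)
  have "GDERIV (barrier g x0 t0 y) (x0, t0) :> (p, - norm p)"
    using GDERIV_barrier[OF g Dg y t0] bspec[OF p y] by simp
  then have up: "\<forall>\<^sub>F X in at (x0, t0). norm (barrier g x0 t0 y X - barrier g x0 t0 y (x0, t0)
      - ?l (X - (x0, t0))) \<le> e * norm (X - (x0, t0))"
    unfolding gderiv_def has_derivative_within_alt2 using e by blast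
  \<comment> \<open>Half of \<open>e\<close>, because both coordinate increments are bounded by the norm of the pair.\<close>
  have low: "\<forall>\<^sub>F (x, t) in at (x0, t0).
      hopf_lax g x0 t0 + (p \<bullet> (x - x0) - norm p * (t - t0))
        - (e / 2) * (norm (x - x0) + \<bar>t - t0\<bar>) \<le> hopf_lax g x t"
    using hopf_lax_lower_expansion[OF Dg C1 t0 p half_gt_zero[OF e]]
    unfolding eventually_at_filter by (auto elim: eventually_mono)
  have pos: "\<forall>\<^sub>F X in at (x0, t0). snd X > 0"
    using eventually_positive_time[OF t0, of x0] unfolding eventually_at_filter
    by eventually_elim simp
  from up low pos
  show "\<forall>\<^sub>F X in at (x0, t0). norm (?u X - ?u (x0, t0) - ?l (X - (x0, t0)))
      \<le> e * norm (X - (x0, t0))"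
  proof eventually_elim
    case (elim X)
    obtain x t where X: "X = (x, t)" by (cases X)
    have lin: "?l (X - (x0, t0)) = p \<bullet> (x - x0) - norm p * (t - t0)"
      by (simp add: X inner_commute)
    have "norm (x - x0) \<le> norm (X - (x0, t0))" "\<bar>t - t0\<bar> \<le> norm (X - (x0, t0))"
      using norm_fst_le[of "x - x0" "t - t0"] norm_snd_le[of "t - t0" "x - x0"] by (simp_all add: X)
    then have "(e / 2) * (norm (x - x0) + \<bar>t - t0\<bar>) \<le> (e / 2) * (2 * norm (X - (x0, t0)))"
      using e by (intro mult_left_mono) auto
    moreover have "hopf_lax g x t \<le> barrier g x0 t0 y X"
      using hopf_lax_le_barrier[OF g y t0] elim(3) by (simp add: X)
    ultimately show ?case
      using elim(1,2) barrier_touches[OF y t0] unfolding lin by (simp add: X abs_le_iff)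
  qed
qed

section \<open>Uniqueness of noncritical minimizers at points of differentiability\<close>

text \<open>The derivative of the solution is that of the barrier of every minimizer. So all minimizers
  have the gradient of \<open>y1\<close>, and a nonzero gradient determines where the minimizer lies.\<close>

lemma minimizers_singleton_if_differentiable:
  fixes g :: "real ^ 'n \<Rightarrow> real"
  assumes Dg: "\<And>y. GDERIV g y :> Dg y" and t0: "t0 > 0"
    and diff: "(\<lambda>(x, t). hopf_lax g x t) differentiable (at (x0, t0))"
    and y1: "y1 \<in> minimizers g x0 t0" and nz: "Dg y1 \<noteq> 0"
  shows "minimizers g x0 t0 = {y1}"
proof -
  note g = GDERIV_imp_continuous_on[OF Dg]
  obtain f' where f': "((\<lambda>(x, t). hopf_lax g x t) has_derivative f') (at (x0, t0))"
    using diff by (auto simp: differentiable_def)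
  have loc: "y = x0 - t0 *\<^sub>R sgn (Dg y1)" if y: "y \<in> minimizers g x0 t0" for y
  proof -
    have eq: "H \<bullet> (Dg y, - norm (Dg y)) = H \<bullet> (Dg y1, - norm (Dg y1))" for H
      using GDERIV_hopf_lax_eq[OF g Dg y t0 f'] GDERIV_hopf_lax_eq[OF g Dg y1 t0 f'] by metis
    have "(Dg y, - norm (Dg y)) = (Dg y1, - norm (Dg y1))"
      using iffD1[OF vector_eq_ldot allI[OF eq]] .
    then have same: "Dg y = Dg y1" by simp
    have "y - x0 = - t0 *\<^sub>R sgn (Dg y1)"
    proof (rule antiparallel_in_ball_unique[OF nz])
      show "norm (y - x0) \<le> t0" using y by (simp add: minimizers_def)
      show "Dg y1 \<bullet> (y - x0) = - (t0 * norm (Dg y1))"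
        using minimizer_gradient_alignment[OF g Dg y] same by simp
    qed
    then show ?thesis by (simp add: algebra_simps)
  qed
  have "y = y1" if "y \<in> minimizers g x0 t0" for y
    using loc[OF that] loc[OF y1] by (rule trans[OF _ sym])
  then show ?thesis using y1 by blast
qed

theorem theorem3p8:
  fixes g :: "real ^ 'n \<Rightarrow> real" and Dg :: "real ^ 'n \<Rightarrow> real ^ 'n"
    and u :: "real ^ 'n \<Rightarrow> real \<Rightarrow> real" and L :: "real ^ 'n \<Rightarrow> real \<Rightarrow> (real ^ 'n) set"
    and x\<^sub>0 :: "real ^ 'n" and t\<^sub>0 :: real
  defines "u \<equiv> hopf_lax g" and "L \<equiv> minimizers g"
  assumes Dg: "\<And>y. GDERIV g y :> Dg y"
    and C1: "continuous_on UNIV Dg"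
    and t0: "t\<^sub>0 > 0"
  shows "(is_singleton (L x\<^sub>0 t\<^sub>0) \<longrightarrow>
           (\<lambda>(x, t). u x t) differentiable (at (x\<^sub>0, t\<^sub>0)) \<and>
           (\<forall>y\<^sub>0\<in>L x\<^sub>0 t\<^sub>0. GDERIV (\<lambda>(x, t). u x t) (x\<^sub>0, t\<^sub>0) :> (Dg y\<^sub>0, - norm (Dg y\<^sub>0)))) \<and>
         (\<not> is_singleton (L x\<^sub>0 t\<^sub>0) \<and> (\<exists>y\<^sub>1\<in>L x\<^sub>0 t\<^sub>0. Dg y\<^sub>1 \<noteq> 0) \<longrightarrow>
           \<not> (\<lambda>(x, t). u x t) differentiable (at (x\<^sub>0, t\<^sub>0))) \<and>
         ((\<forall>y\<in>L x\<^sub>0 t\<^sub>0. Dg y = 0) \<longrightarrow>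
           (\<lambda>(x, t). u x t) differentiable (at (x\<^sub>0, t\<^sub>0)) \<and>
           GDERIV (\<lambda>(x, t). u x t) (x\<^sub>0, t\<^sub>0) :> 0)"
proof (intro conjI impI)
  note g = GDERIV_imp_continuous_on[OF Dg]
  have differentiable: "(\<lambda>(x, t). u x t) differentiable (at (x\<^sub>0, t\<^sub>0))"
    if "GDERIV (\<lambda>(x, t). u x t) (x\<^sub>0, t\<^sub>0) :> D" for D
    using that unfolding gderiv_def differentiable_def by blast
  have common: "GDERIV (\<lambda>(x, t). u x t) (x\<^sub>0, t\<^sub>0) :> (p, - norm p)"
    if "\<And>y. y \<in> L x\<^sub>0 t\<^sub>0 \<Longrightarrow> Dg y = p" for p
    using GDERIV_hopf_lax[OF Dg C1 t0, of "x\<^sub>0" p] that unfolding u_def L_def by blast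
  {
    assume "is_singleton (L x\<^sub>0 t\<^sub>0)"
    then obtain y where y: "L x\<^sub>0 t\<^sub>0 = {y}" by (auto simp: is_singleton_def)
    have "GDERIV (\<lambda>(x, t). u x t) (x\<^sub>0, t\<^sub>0) :> (Dg y, - norm (Dg y))"
      using common[of "Dg y"] y by simp
    then show "(\<lambda>(x, t). u x t) differentiable (at (x\<^sub>0, t\<^sub>0))"
      and "\<forall>y\<^sub>0\<in>L x\<^sub>0 t\<^sub>0. GDERIV (\<lambda>(x, t). u x t) (x\<^sub>0, t\<^sub>0) :> (Dg y\<^sub>0, - norm (Dg y\<^sub>0))"
      using differentiable y by auto
  next
    assume "\<not> is_singleton (L x\<^sub>0 t\<^sub>0) \<and> (\<exists>y\<^sub>1\<in>L x\<^sub>0 t\<^sub>0. Dg y\<^sub>1 \<noteq> 0)"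
    then show "\<not> (\<lambda>(x, t). u x t) differentiable (at (x\<^sub>0, t\<^sub>0))"
      using minimizers_singleton_if_differentiable[OF Dg t0] unfolding u_def L_def
      by (metis is_singletonI)
  next
    assume "\<forall>y\<in>L x\<^sub>0 t\<^sub>0. Dg y = 0"
    then show "GDERIV (\<lambda>(x, t). u x t) (x\<^sub>0, t\<^sub>0) :> 0"
      using common[of 0] by (simp add: zero_prod_def)
    then show "(\<lambda>(x, t). u x t) differentiable (at (x\<^sub>0, t\<^sub>0))"
      by (rule differentiable)
  }
qed

end
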